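(* Let $g\colon\mathbf{R}^n\to\mathbf{R}\cup\{+\infty\}$ be a proper closed convex function, $h\colon\mathbf{R}^m\to\mathbf{R}$ a finite-valued convex function that is $L$-Lipschitz continuous, and $c\colon\mathbf{R}^n\to\mathbf{R}^m$ a $C^1$-smooth mapping whose Jacobian $\nabla c$ is $\beta$-Lipschitz continuous. Let $\varphi(x):=g(x)+h(c(x))$. Then for any real $t>0$ and any $x\in\mathbf{R}^n$ there exists a point $\hat x$ satisfying (i) (point proximity) $\|x^t-\hat x\|\le\|x^t-x\|$, (ii) (value proximity) $\varphi(\hat x)-\varphi(x^t)\le\frac{t}{2}(L\beta t+1)\|\mathcal{G}_t(x)\|^2$, (iii) (near-stationarity) $\mathrm{dist}\big(0;\partial\varphi(\hat x)\big)\le(3L\beta t+2)\|\mathcal{G}_t(x)\|$.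
   Context: For $x,y\in\mathbf{R}^n$ set $\varphi(x;y):=g(y)+h\big(c(x)+\nabla c(x)(y-x)\big)$ and $\varphi_t(x;y):=\varphi(x;y)+\frac1{2t}\|x-y\|^2$. Define $x^t:=\operatorname{argmin}_y\varphi_t(x;y)$ and the prox-gradient mapping $\mathcal{G}_t(x):=t^{-1}(x-x^t)$. The subdifferential is $\partial\varphi(x):=\partial g(x)+\nabla c(x)^T\partial h(c(x))$, where $\partial g,\partial h$ are convex subdifferentials. $\mathrm{dist}(0;Q)=\inf_{v\in Q}\|v\|$ ($+\infty$ if $Q=\emptyset$). Lipschitz continuity of $\nabla c$ is in the operator norm. *)

theory Defs
  imports "HOL-Analysis.Analysis"
begin

text \<open>The library's \<open>epigraph\<close> covers real-valued functions only; here \<open>g\<close> takes values in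
  \<open>ereal\<close> and the epigraph is a subset of the ordinary product with \<open>real\<close>.\<close>

definition ereal_epigraph :: "('a \<Rightarrow> ereal) \<Rightarrow> ('a \<times> real) set" where
  "ereal_epigraph g = {(x, r). g x \<le> ereal r}"

definition proper_closed_convex :: "('a::real_normed_vector \<Rightarrow> ereal) \<Rightarrow> bool" where
  "proper_closed_convex g \<longleftrightarrow>
     (\<forall>x. g x \<noteq> -\<infinity>) \<and> (\<exists>x. g x \<noteq> \<infinity>) \<and>
     closed (ereal_epigraph g) \<and> convex (ereal_epigraph g)"

text \<open>The subdifferential is empty outside the effective domain.\<close>

definition convex_subdifferential :: "('a::real_inner \<Rightarrow> ereal) \<Rightarrow> 'a \<Rightarrow> 'a set" where
  "convex_subdifferential g x =
     {v. \<bar>g x\<bar> \<noteq> \<infinity> \<and> (\<forall>y. g y \<ge> g x + ereal (v \<bullet> (y - x)))}"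

definition composite ::
  "(real^'n \<Rightarrow> ereal) \<Rightarrow> (real^'m \<Rightarrow> real) \<Rightarrow> (real^'n \<Rightarrow> real^'m) \<Rightarrow> real^'n \<Rightarrow> ereal" where
  "composite g h c x = g x + ereal (h (c x))"

definition prox_linear_model ::
  "(real^'n \<Rightarrow> ereal) \<Rightarrow> (real^'m \<Rightarrow> real) \<Rightarrow> (real^'n \<Rightarrow> real^'m) \<Rightarrow>
     real^'n \<Rightarrow> real^'n \<Rightarrow> ereal" where
  "prox_linear_model g h c x y =
     g y + ereal (h (c x + jacobian c (at x) *v (y - x)))"

definition prox_linear_model_reg ::
  "(real^'n \<Rightarrow> ereal) \<Rightarrow> (real^'m \<Rightarrow> real) \<Rightarrow> (real^'n \<Rightarrow> real^'m) \<Rightarrow>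
     real \<Rightarrow> real^'n \<Rightarrow> real^'n \<Rightarrow> ereal" where
  "prox_linear_model_reg g h c t x y =
     prox_linear_model g h c x y + ereal (1 / (2 * t) * (norm (x - y))\<^sup>2)"

text \<open>\<open>arg_min\<close> is a choice of a global minimizer. For proper closed convex \<open>g\<close>, finite convex
  \<open>h\<close> and \<open>t > 0\<close> the function minimized is proper, closed and strongly convex, so that the
  minimizer exists and is unique.\<close>

definition prox_point ::
  "(real^'n \<Rightarrow> ereal) \<Rightarrow> (real^'m \<Rightarrow> real) \<Rightarrow> (real^'n \<Rightarrow> real^'m) \<Rightarrow>
     real \<Rightarrow> real^'n \<Rightarrow> real^'n" where
  "prox_point g h c t x = arg_min_on (prox_linear_model_reg g h c t x) UNIV"

definition prox_gradient ::
  "(real^'n \<Rightarrow> ereal) \<Rightarrow> (real^'m \<Rightarrow> real) \<Rightarrow> (real^'n \<Rightarrow> real^'m) \<Rightarrow>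
     real \<Rightarrow> real^'n \<Rightarrow> real^'n" where
  "prox_gradient g h c t x = (1 / t) *\<^sub>R (x - prox_point g h c t x)"

definition composite_subdifferential ::
  "(real^'n \<Rightarrow> ereal) \<Rightarrow> (real^'m \<Rightarrow> real) \<Rightarrow> (real^'n \<Rightarrow> real^'m) \<Rightarrow>
     real^'n \<Rightarrow> (real^'n) set" where
  "composite_subdifferential g h c x =
     {v + transpose (jacobian c (at x)) *v w | v w.
        v \<in> convex_subdifferential g x \<and>
        w \<in> convex_subdifferential (\<lambda>z. ereal (h z)) (c x)}"

text \<open>Unlike the library's \<open>infdist\<close>, this distance to the empty set is \<open>\<infinity>\<close> and not \<open>0\<close>.\<close>

definition dist_origin :: "'a::real_normed_vector set \<Rightarrow> ereal" where
  "dist_origin Q = (INF v\<in>Q. ereal (norm v))"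

end

theory Submission
  imports Defs
begin

text \<open>Let \<open>p\<close> be the prox point, \<open>\<delta> = \<parallel>p - x\<parallel>\<close>, and
  \<open>\<zeta> y = \<phi> y + (L \<beta> + 1/t) / 2 * \<parallel>y - x\<parallel>\<^sup>2\<close>. The prox-linear model differs from \<open>\<phi>\<close> by at most
  \<open>L \<beta> / 2 * \<parallel>y - x\<parallel>\<^sup>2\<close>, so \<open>p\<close> minimizes \<open>\<zeta>\<close> up to an error \<open>L \<beta> \<delta>\<^sup>2\<close>. In finite dimensions
  Ekeland's principle can be replaced by penalization: \<open>\<zeta> y + L \<beta> \<delta> \<parallel>y - p\<parallel>\<close> has its
  minimum over the ball of radius \<open>\<delta>\<close> around \<open>p\<close>, and by the error bound this minimum is global.
  The minimizer is the required point: its first-order optimality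
  condition is near-stationarity for \<open>\<phi>\<close>.\<close>

section \<open>Minima of extended-valued functions with closed epigraph\<close>

lemma closed_ereal_epigraph_add:
  fixes f :: "'a::topological_space \<Rightarrow> ereal"
  assumes "closed (ereal_epigraph f)" "continuous_on UNIV q"
  shows "closed (ereal_epigraph (\<lambda>x. f x + ereal (q x)))"
proof -
  have "ereal_epigraph (\<lambda>x. f x + ereal (q x))
      = (\<lambda>(x, r). (x, r - q x)) -` ereal_epigraph f"
  proof -
    have "f x + ereal (q x) \<le> ereal r \<longleftrightarrow> f x \<le> ereal (r - q x)" for x r
      by (cases "f x") auto
    then show ?thesis
      by (auto simp: ereal_epigraph_def)
  qed
  moreover have "continuous_on UNIV (\<lambda>(x, r). (x, r - q x))"
    unfolding case_prod_beta
    by (intro continuous_intros continuous_on_compose2[OF assms(2)]) auto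
  ultimately show ?thesis
    using closed_vimage[OF assms(1)] by simp
qed

text \<open>The sublevel sets at levels above the infimum are closed and nested, and each meets
  \<open>S\<close>, so by compactness some point of \<open>S\<close> lies in all of them. An
  infinite infimum needs no separate case; for \<infinity> the family is empty.\<close>

lemma closed_epigraph_attains_min:
  fixes f :: "'a::t2_space \<Rightarrow> ereal"
  assumes "closed (ereal_epigraph f)" "compact S" "S \<noteq> {}"
  shows "\<exists>x\<in>S. \<forall>y\<in>S. f x \<le> f y"
proof -
  define m where "m = (INF x\<in>S. f x)"
  define F where "F = (\<lambda>r. {x. f x \<le> ereal r}) ` {r. m < ereal r}"
  have cl: "closed {x. f x \<le> ereal r}" for r
  proof -
    have "{x. f x \<le> ereal r} = (\<lambda>x. (x, r)) -` ereal_epigraph f"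
      by (auto simp: ereal_epigraph_def)
    moreover have "continuous_on UNIV (\<lambda>x::'a. (x, r))"
      by (intro continuous_intros)
    ultimately show ?thesis
      using closed_vimage[OF assms(1)] by simp
  qed
  have "S \<inter> \<Inter>F \<noteq> {}"
  proof (rule compact_imp_fip[OF assms(2)])
    show "closed T" if "T \<in> F" for T
      using that cl by (auto simp: F_def)
    fix F' assume "finite F'" "F' \<subseteq> F"
    then obtain R where R: "finite R" "R \<subseteq> {r. m < ereal r}"
        "F' = (\<lambda>r. {x. f x \<le> ereal r}) ` R"
      unfolding F_def by (meson finite_subset_image)
    show "S \<inter> \<Inter>F' \<noteq> {}"
    proof (cases "R = {}")
      case True
      then show ?thesis using R assms(3) by auto
    next
      case False
      then have "m < ereal (Min R)"
        using R Min_in by blast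
      then obtain x where "x \<in> S" "f x < ereal (Min R)"
        unfolding m_def by (auto simp: INF_less_iff)
      moreover have "f x \<le> ereal r" if "r \<in> R" for r
      proof -
        have "ereal (Min R) \<le> ereal r" using that R by simp
        then show ?thesis using \<open>f x < ereal (Min R)\<close> by (meson less_imp_le order_trans)
      qed
      ultimately have "x \<in> S \<inter> \<Inter>F'"
        using R by auto
      then show ?thesis by blast
    qed
  qed
  then obtain x where x: "x \<in> S" "\<And>r. m < ereal r \<Longrightarrow> f x \<le> ereal r"
    by (auto simp: F_def)
  have "f x \<le> m"
  proof (rule ccontr)
    assume "\<not> f x \<le> m"
    then obtain r where "m < ereal r" "ereal r < f x"
      using ereal_dense2 by (metis not_le)
    then show False using x(2) by fastforce
  qed
  then show ?thesis
    using x(1) unfolding m_def by (meson INF_lower order_trans)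
qed

section \<open>Linear lower bounds for convex functions and existence of the prox point\<close>

lemma convex_epigraphD:
  assumes "convex (ereal_epigraph g)" "g x \<le> ereal r" "g y \<le> ereal s"
    "u \<ge> 0" "v \<ge> 0" "u + v = 1"
  shows "g (u *\<^sub>R x + v *\<^sub>R y) \<le> ereal (u * r + v * s)"
  using convexD[OF assms(1), of "(x, r)" "(y, s)" u v] assms
  by (auto simp: ereal_epigraph_def)

text \<open>A lower bound on a unit sphere centered in the domain spreads along rays by convexity.\<close>

lemma proper_closed_convex_linear_lower_bound:
  fixes g :: "'a::euclidean_space \<Rightarrow> ereal"
  assumes "proper_closed_convex g"
  shows "\<exists>a b. \<forall>y. ereal (- a - b * norm y) \<le> g y"
proof -
  obtain x0 where x0: "g x0 \<noteq> \<infinity>" and ninf: "\<And>y. g y \<noteq> -\<infinity>"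
    and cl: "closed (ereal_epigraph g)" and cv: "convex (ereal_epigraph g)"
    using assms by (auto simp: proper_closed_convex_def)
  obtain G0 where G0: "g x0 = ereal G0"
    using x0 ninf by (metis ereal_cases)
  obtain z where z: "z \<in> cball x0 1" "\<And>y. y \<in> cball x0 1 \<Longrightarrow> g z \<le> g y"
    using closed_epigraph_attains_min[OF cl, of "cball x0 1"] by auto
  have "g z \<le> g x0" using z(2)[of x0] by simp
  then obtain m where m: "g z = ereal m" "m \<le> G0"
    using G0 ninf by (cases "g z") auto
  have "ereal (m - (G0 - m) * norm (y - x0)) \<le> g y" for y
  proof (cases "g y")
    case (real r)
    define s where "s = norm (y - x0)"
    show ?thesis
    proof (cases "s \<le> 1")
      case True
      then have "g z \<le> g y"
        by (intro z(2)) (simp add: s_def dist_norm norm_minus_commute)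
      then have "m \<le> r" using m real by simp
      moreover have "(G0 - m) * s \<ge> 0" using m by (simp add: s_def)
      ultimately have "m - (G0 - m) * s \<le> r" by linarith
      then show ?thesis using real by (simp add: s_def)
    next
      case False
      \<comment> \<open>\<open>w\<close> is where the segment from \<open>x0\<close> to
        \<open>y\<close> crosses the unit sphere around \<open>x0\<close>. Solving convexity at
        \<open>w\<close> for \<open>r\<close> bounds it below by \<open>G0 - (G0 - m) * s\<close>;
        weakening the constant \<open>G0\<close> to \<open>m\<close> gives a bound that serves both
        cases.\<close>
      define w where "w = (1 - 1/s) *\<^sub>R x0 + (1/s) *\<^sub>R y"
      have "g w \<le> ereal ((1 - 1/s) * G0 + (1/s) * r)"
        unfolding w_def using False G0 real
        by (intro convex_epigraphD[OF cv]) auto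
      moreover have "g z \<le> g w"
      proof (intro z(2))
        have "w - x0 = (1/s) *\<^sub>R (y - x0)"
          by (simp add: w_def algebra_simps)
        then have "norm (w - x0) = 1"
          using False by (cases "y = x0") (simp_all add: s_def)
        then show "w \<in> cball x0 1"
          by (simp add: dist_norm norm_minus_commute)
      qed
      ultimately have "m \<le> (1 - 1/s) * G0 + (1/s) * r"
        using m by (metis ereal_less_eq(3) order_trans)
      then have "s * m \<le> (s - 1) * G0 + r"
        using False by (simp add: field_simps)
      moreover have "m \<le> G0" by fact
      ultimately have "m - (G0 - m) * s \<le> r"
        by (simp add: algebra_simps)
      then show ?thesis using real by (simp add: s_def)
    qed
  qed (use ninf in auto)
  moreover have "- ((G0 - m) * norm x0 - m) - (G0 - m) * norm y \<le> m - (G0 - m) * norm (y - x0)" for y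
  proof -
    have "(G0 - m) * norm (y - x0) \<le> (G0 - m) * (norm y + norm x0)"
      using m by (intro mult_left_mono norm_triangle_ineq4) auto
    then show ?thesis by (simp add: algebra_simps)
  qed
  ultimately have "ereal (- ((G0 - m) * norm x0 - m) - (G0 - m) * norm y) \<le> g y" for y
    by (metis ereal_less_eq(3) order_trans)
  then show ?thesis by blast
qed

text \<open>Coercivity: the quadratic growth of \<open>q\<close> outweighs the at most linear
  descent of \<open>g\<close>, so outside a large ball the sum is at least its value at a fixed
  domain point, and a minimum over the ball is global.\<close>

lemma proper_closed_convex_add_attains_min:
  fixes g :: "'a::euclidean_space \<Rightarrow> ereal"
  assumes "proper_closed_convex g" "continuous_on UNIV q" "\<alpha> > 0"
    and q: "\<And>y. q y \<ge> \<alpha> * (norm y)\<^sup>2 - b * norm y - a"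
  shows "\<exists>x. \<forall>y. g x + ereal (q x) \<le> g y + ereal (q y)"
proof -
  obtain x0 where x0: "g x0 \<noteq> \<infinity>" and ninf: "\<And>y. g y \<noteq> -\<infinity>"
    and cl: "closed (ereal_epigraph g)"
    using assms by (auto simp: proper_closed_convex_def)
  obtain G0 where G0: "g x0 = ereal G0"
    using x0 ninf by (metis ereal_cases)
  obtain a' b' where g: "\<And>y. ereal (- a' - b' * norm y) \<le> g y"
    using proper_closed_convex_linear_lower_bound[OF assms(1)] by blast
  define F where "F = G0 + q x0"
  \<comment> \<open>The entry 1 allows multiplying an estimate by \<open>norm y\<close>,
    \<open>norm x0\<close> puts the comparison point into the ball, and the quotient makes
    \<open>\<alpha> * norm y - (b + b')\<close> dominate the constants.\<close>
  define R where "R = Max {1, norm x0, (\<bar>b + b'\<bar> + \<bar>a + a'\<bar> + \<bar>F\<bar>) / \<alpha>}"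
  have R: "1 \<le> R" "norm x0 \<le> R" "(\<bar>b + b'\<bar> + \<bar>a + a'\<bar> + \<bar>F\<bar>) / \<alpha> \<le> R"
    unfolding R_def by (rule Max_ge; simp)+
  have outside: "ereal F \<le> g y + ereal (q y)" if "norm y > R" for y
  proof -
    have "\<bar>b + b'\<bar> + \<bar>a + a'\<bar> + \<bar>F\<bar> \<le> \<alpha> * R"
      using R(3) \<open>\<alpha> > 0\<close> by (simp add: field_simps)
    also have "\<dots> \<le> \<alpha> * norm y" using that \<open>\<alpha> > 0\<close> by simp
    finally have 1: "\<bar>a + a'\<bar> + \<bar>F\<bar> \<le> \<alpha> * norm y - (b + b')" by linarith
    have "\<bar>a + a'\<bar> + \<bar>F\<bar> \<le> norm y * (\<alpha> * norm y - (b + b'))"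
      using mult_mono[of 1 "norm y", OF _ 1] R(1) that by simp
    then have "F \<le> norm y * (\<alpha> * norm y - (b + b')) - (a + a')"
      using abs_ge_self[of F] abs_ge_self[of "a + a'"] by simp
    also have "\<dots> = (- a' - b' * norm y) + (\<alpha> * (norm y)\<^sup>2 - b * norm y - a)"
      by (simp add: algebra_simps power2_eq_square)
    finally have "F \<le> (- a' - b' * norm y) + q y" using q[of y] by linarith
    then have "ereal F \<le> ereal (- a' - b' * norm y) + ereal (q y)" by simp
    also have "\<dots> \<le> g y + ereal (q y)" by (intro add_right_mono g)
    finally show ?thesis .
  qed
  have "cball (0::'a) R \<noteq> {}" using R(1) by simp
  then obtain x where x: "\<And>y. y \<in> cball 0 R \<Longrightarrow> g x + ereal (q x) \<le> g y + ereal (q y)"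
    using closed_epigraph_attains_min[OF closed_ereal_epigraph_add[OF cl assms(2)] compact_cball]
    by blast
  have "g x + ereal (q x) \<le> g y + ereal (q y)" for y
  proof (cases "norm y \<le> R")
    case True
    then show ?thesis using x by simp
  next
    case False
    have "g x + ereal (q x) \<le> ereal F"
      using x[of x0] R(2) by (simp add: F_def G0)
    then show ?thesis using outside[of y] False by auto
  qed
  then show ?thesis by blast
qed

text \<open>The choice behind \<open>arg_min_on\<close> is meaningful only once a minimizer exists.
  Lipschitz continuity keeps the descent of \<open>h\<close> along the affine model linear, and the
  quadratic term dominates it.\<close>

lemma prox_point_minimizes:
  assumes "proper_closed_convex g" "L-lipschitz_on UNIV h" "t > 0"
  shows "prox_linear_model_reg g h c t x (prox_point g h c t x) \<le> prox_linear_model_reg g h c t x y"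
proof -
  define A where "A = jacobian c (at x)"
  define q where "q y = h (c x + A *v (y - x)) + 1 / (2 * t) * (norm (x - y))\<^sup>2" for y
  have eq: "prox_linear_model_reg g h c t x y = g y + ereal (q y)" for y
    unfolding prox_linear_model_reg_def prox_linear_model_def q_def A_def
    by (cases "g y") auto
  have L: "L \<ge> 0" using assms(2) lipschitz_on_nonneg by blast
  have cont: "continuous_on UNIV q"
    unfolding q_def
    by (intro continuous_intros continuous_on_compose2[OF lipschitz_on_continuous_on[OF assms(2)]]
        linear_continuous_on_compose[OF _ matrix_vector_mul_linear]) auto
  define B where "B = onorm ((*v) A)"
  have lower: "q y \<ge> 1 / (2 * t) * (norm y)\<^sup>2 - (norm x / t + L * B) * norm y
      - (L * B * norm x - h (c x))" for y
  proof -
    have "dist (h (c x + A *v (y - x))) (h (c x)) \<le> L * dist (c x + A *v (y - x)) (c x)"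
      using assms(2) by (auto simp: lipschitz_on_def)
    moreover have "norm (A *v (y - x)) \<le> B * norm (y - x)"
      unfolding B_def by (rule onorm) simp
    moreover have "B * norm (y - x) \<le> B * (norm y + norm x)"
      unfolding B_def by (intro mult_left_mono norm_triangle_ineq4 onorm_pos_le) simp
    ultimately have "dist (h (c x + A *v (y - x))) (h (c x)) \<le> L * (B * (norm y + norm x))"
      using L by (smt (verit) dist_norm add_diff_cancel_left' mult_left_mono)
    then have 1: "h (c x + A *v (y - x)) \<ge> h (c x) - L * (B * (norm y + norm x))"
      by (simp add: dist_real_def)
    \<comment> \<open>The reverse triangle inequality bounds the proximal term below by a polynomial
      in \<open>norm y\<close> alone.\<close>
    have "(norm y - norm x)\<^sup>2 \<le> (norm (x - y))\<^sup>2"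
      using norm_triangle_ineq3[of y x]
      by (simp add: abs_le_square_iff[symmetric] norm_minus_commute)
    then have "1 / (2 * t) * (norm y - norm x)\<^sup>2 \<le> 1 / (2 * t) * (norm (x - y))\<^sup>2"
      using assms(3) by (intro mult_left_mono) auto
    moreover have "1 / (2 * t) * (norm y - norm x)\<^sup>2 
        = 1 / (2 * t) * (norm y)\<^sup>2 - norm x / t * norm y + 1 / (2 * t) * (norm x)\<^sup>2"
      using assms(3) by (simp add: field_simps power2_eq_square)
    moreover have "1 / (2 * t) * (norm x)\<^sup>2 \<ge> 0" using assms(3) by simp
    ultimately show ?thesis using 1 unfolding q_def by (simp add: algebra_simps)
  qed
  obtain z where z: "\<And>y. g z + ereal (q z) \<le> g y + ereal (q y)"
    using proper_closed_convex_add_attains_min[OF assms(1) cont _ lower] assms(3) by auto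
  then have "is_arg_min (prox_linear_model_reg g h c t x) (\<lambda>y. y \<in> UNIV) z"
    by (auto simp: is_arg_min_def eq not_less)
  then have "is_arg_min (prox_linear_model_reg g h c t x) (\<lambda>y. y \<in> UNIV) (prox_point g h c t x)"
    unfolding prox_point_def arg_min_on_def arg_min_def by (rule someI)
  then show ?thesis by (auto simp: is_arg_min_def not_less)
qed

section \<open>Linearization error of a smooth map\<close>

text \<open>At parameter \<open>s\<close> of the segment from \<open>x\<close> to \<open>y\<close>
  the Jacobian differs from the one at \<open>x\<close> by at most
  \<open>\<beta> * s * norm (y - x)\<close>. Integrating \<open>s\<close> over the unit interval
  produces the factor 1/2.\<close>

lemma linearization_error:
  fixes c :: "real^'n \<Rightarrow> real^'m"
  assumes "\<forall>z. c differentiable (at z)"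
    and "\<forall>y z. onorm ((*v) (jacobian c (at y) - jacobian c (at z))) \<le> \<beta> * norm (y - z)"
  shows "norm (c y - (c x + jacobian c (at x) *v (y - x))) \<le> \<beta> / 2 * (norm (y - x))\<^sup>2"
proof -
  define A where "A = jacobian c (at x)"
  define d where "d = y - x"
  define f where "f s = c (x + s *\<^sub>R d) - s *\<^sub>R (A *v d)" for s
  have cd: "(c has_derivative (\<lambda>k. jacobian c (at z) *v k)) (at z)" for z
    using assms(1) jacobian_works by blast
  have fd: "(f has_vector_derivative ((jacobian c (at (x + s *\<^sub>R d)) - A) *v d)) (at s)" for s
  proof -
    have "((\<lambda>s. c (x + s *\<^sub>R d)) has_derivative (\<lambda>u. jacobian c (at (x + s *\<^sub>R d)) *v (u *\<^sub>R d))) (at s)"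
      by (rule has_derivative_compose[OF _ cd]) (auto intro!: derivative_eq_intros)
    then show ?thesis
      unfolding f_def has_vector_derivative_def
      by (auto intro!: derivative_eq_intros
          simp: matrix_vector_mult_diff_rdistrib matrix_vector_mult_scaleR algebra_simps)
  qed
  \<comment> \<open>The mean value inequality replaces the integral: the speed of \<open>f\<close>
    is at most the derivative of \<open>\<beta> / 2 * (norm d)\<^sup>2 * s\<^sup>2\<close>.\<close>
  have "norm (f 1 - f 0) \<le> \<beta> / 2 * (norm d)\<^sup>2 * 1\<^sup>2 - \<beta> / 2 * (norm d)\<^sup>2 * 0\<^sup>2"
  proof (rule differentiable_bound_general)
    show "continuous_on {0..1} f"
      using fd has_vector_derivative_continuous continuous_at_imp_continuous_on by blast
    show "((\<lambda>s. \<beta> / 2 * (norm d)\<^sup>2 * s\<^sup>2) has_vector_derivative (\<beta> * (norm d)\<^sup>2 * s)) (at s)" for s :: real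
      unfolding has_real_derivative_iff_has_vector_derivative[symmetric]
      by (auto intro!: derivative_eq_intros)
    fix s :: real assume "0 < s" "s < 1"
    show "(f has_vector_derivative ((jacobian c (at (x + s *\<^sub>R d)) - A) *v d)) (at s)" by (rule fd)
    have "norm ((jacobian c (at (x + s *\<^sub>R d)) - A) *v d)
        \<le> onorm ((*v) (jacobian c (at (x + s *\<^sub>R d)) - A)) * norm d"
      by (rule onorm) simp
    also have "\<dots> \<le> (\<beta> * norm ((x + s *\<^sub>R d) - x)) * norm d"
      unfolding A_def by (intro mult_right_mono assms(2)[rule_format] norm_ge_zero)
    also have "\<dots> = \<beta> * (norm d)\<^sup>2 * s"
      using \<open>0 < s\<close> by (simp add: power2_eq_square)
    finally show "norm ((jacobian c (at (x + s *\<^sub>R d)) - A) *v d) \<le> \<beta> * (norm d)\<^sup>2 * s" .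
  qed (auto intro!: continuous_intros)
  then show ?thesis
    by (simp add: f_def d_def A_def algebra_simps)
qed

section \<open>Separation and an approximate chain rule for subgradients\<close>

text \<open>Separating the origin from the values \<open>(A d - k, d - e, r)\<close> with
  \<open>r\<close> above \<open>g (x + d) - g x + h (z + k) - h z + M \<parallel>e\<parallel>\<close> produces both subgradients at once.\<close>

lemma approximate_subdifferential_chain_rule:
  fixes g :: "real^'n \<Rightarrow> ereal" and h :: "real^'m \<Rightarrow> real" and A :: "real^'n^'m"
  assumes cg: "convex (ereal_epigraph g)" and ch: "convex_on UNIV h" and "M \<ge> 0"
    and G0: "g x = ereal G0"
    and min: "\<And>d. g x + ereal (h z) \<le> g (x + d) + ereal (h (z + A *v d) + M * norm d)"
  shows "\<exists>v \<in> convex_subdifferential g x. \<exists>w \<in> convex_subdifferential (\<lambda>z. ereal (h z)) z.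
    norm (v + transpose A *v w) \<le> M"
proof -
  \<comment> \<open>\<open>k\<close> and \<open>e\<close> are free copies of \<open>A *v d\<close>
    and \<open>d\<close>; zeros in the first two components couple them again. The strict
    inequality, together with \<open>min\<close>, keeps the origin out.\<close>
  define S where "S = {(A *v d - k, d - e, r) | d k e r.
    \<exists>p. g (x + d) \<le> ereal p \<and> p - G0 + (h (z + k) - h z) + M * norm e < r}"
  have "convex S"
  proof (rule convexI)
    fix X Y and u v :: real
    assume uv: "0 \<le> u" "0 \<le> v" "u + v = 1" and "X \<in> S" "Y \<in> S"
    then obtain d k e r p d' k' e' r' p' where
      X: "X = (A *v d - k, d - e, r)" "g (x + d) \<le> ereal p"
        "p - G0 + (h (z + k) - h z) + M * norm e < r" and
      Y: "Y = (A *v d' - k', d' - e', r')" "g (x + d') \<le> ereal p'"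
        "p' - G0 + (h (z + k') - h z) + M * norm e' < r'"
      unfolding S_def by blast
    have comb: "x + (u *\<^sub>R d + v *\<^sub>R d') = u *\<^sub>R (x + d) + v *\<^sub>R (x + d')"
      "z + (u *\<^sub>R k + v *\<^sub>R k') = u *\<^sub>R (z + k) + v *\<^sub>R (z + k')"
      using uv by (simp_all add: algebra_simps flip: scaleR_add_left)
    have "g (x + (u *\<^sub>R d + v *\<^sub>R d')) \<le> ereal (u * p + v * p')"
      unfolding comb by (rule convex_epigraphD[OF cg X(2) Y(2) uv])
    moreover have "(u * p + v * p') - G0 + (h (z + (u *\<^sub>R k + v *\<^sub>R k')) - h z)
        + M * norm (u *\<^sub>R e + v *\<^sub>R e') < u * r + v * r'"
    proof -
      have "h (z + (u *\<^sub>R k + v *\<^sub>R k')) \<le> u * h (z + k) + v * h (z + k')"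
        unfolding comb using ch uv by (auto simp: convex_on_def)
      moreover have "M * norm (u *\<^sub>R e + v *\<^sub>R e') \<le> M * (u * norm e + v * norm e')"
        using uv \<open>M \<ge> 0\<close> norm_triangle_ineq[of "u *\<^sub>R e" "v *\<^sub>R e'"]
        by (intro mult_left_mono) auto
      \<comment> \<open>Strictness needs a positive weight; if \<open>u = 0\<close>, then
        \<open>v = 1\<close> supplies it.\<close>
      moreover have "u * (p - G0 + (h (z + k) - h z) + M * norm e)
          + v * (p' - G0 + (h (z + k') - h z) + M * norm e') < u * r + v * r'"
        using X(3) Y(3) uv
        by (cases "u = 0") (auto intro!: add_less_le_mono mult_left_mono)
      moreover have "u * (p - G0 + (h (z + k) - h z) + M * norm e)
          + v * (p' - G0 + (h (z + k') - h z) + M * norm e')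
        = (u * p + v * p') - (u + v) * G0 + (u * h (z + k) + v * h (z + k') - (u + v) * h z)
          + M * (u * norm e + v * norm e')"
        by (simp add: algebra_simps)
      ultimately show ?thesis using uv(3) by simp
    qed
    moreover have "u *\<^sub>R X + v *\<^sub>R Y = (A *v (u *\<^sub>R d + v *\<^sub>R d') - (u *\<^sub>R k + v *\<^sub>R k'),
        (u *\<^sub>R d + v *\<^sub>R d') - (u *\<^sub>R e + v *\<^sub>R e'), u * r + v * r')"
      using X(1) Y(1)
      by (simp add: matrix_vector_right_distrib matrix_vector_mult_scaleR algebra_simps)
    ultimately show "u *\<^sub>R X + v *\<^sub>R Y \<in> S"
      unfolding S_def by blast
  qed
  moreover have "0 \<notin> S"
  proof
    assume "0 \<in> S"
    then obtain d p where "g (x + d) \<le> ereal p" "p - G0 + (h (z + A *v d) - h z) + M * norm d < 0"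
      unfolding S_def by (auto simp: zero_prod_def)
    moreover have "g x + ereal (h z) \<le> ereal p + ereal (h (z + A *v d) + M * norm d)"
      using min[of d] \<open>g (x + d) \<le> ereal p\<close> by (meson add_right_mono order_trans)
    ultimately show False using G0 by simp
  qed
  ultimately obtain \<nu> where \<nu>: "\<nu> \<noteq> 0" "\<And>X. X \<in> S \<Longrightarrow> 0 \<le> \<nu> \<bullet> X"
    using separating_hyperplane_set_0 by blast
  obtain a b \<tau> where \<nu>_eq: "\<nu> = (a, b, \<tau>)" by (cases \<nu>) auto
  have sep: "0 \<le> a \<bullet> (A *v d - k) + b \<bullet> (d - e) + \<tau> * r"
    if "g (x + d) \<le> ereal p" "p - G0 + (h (z + k) - h z) + M * norm e < r" for d k e r p
    using \<nu>(2)[of "(A *v d - k, d - e, r)"] that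
    unfolding S_def \<nu>_eq by (simp add: add.assoc) blast
  have \<tau>0: "0 \<le> \<tau>"
    using sep[of 0 G0 0 0 1] G0 by simp
  \<comment> \<open>With \<open>\<tau> = 0\<close> the height \<open>r\<close> drops out, so the
    functional would be nonnegative for \<open>d = 0\<close> and all \<open>k\<close>,
    \<open>e\<close>. Taking \<open>k = a\<close> and \<open>e = b\<close> makes it vanish.\<close>
  have "\<tau> \<noteq> 0"
  proof
    assume "\<tau> = 0"
    then have "0 \<le> a \<bullet> (- k) + b \<bullet> (- e)" for k e
      using sep[of 0 G0 k e "(h (z + k) - h z) + M * norm e + 1"] G0 by simp
    from this[of a b] have "a \<bullet> a = 0" "b \<bullet> b = 0"
      using inner_ge_zero[of a] inner_ge_zero[of b] by (simp_all only: inner_minus_right)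
    then have "a = 0 \<and> b = 0" by simp
    then show False using \<nu>(1) \<open>\<tau> = 0\<close> by (simp add: \<nu>_eq zero_prod_def)
  qed
  then have \<tau>: "\<tau> > 0" using \<tau>0 by simp
  define a' b' where "a' = a /\<^sub>R \<tau>" and "b' = b /\<^sub>R \<tau>"
  have a'_inner: "a' \<bullet> u = a \<bullet> u / \<tau>" for u
    by (simp add: a'_def divide_inverse mult.commute)
  have b'_inner: "b' \<bullet> u = b \<bullet> u / \<tau>" for u
    by (simp add: b'_def divide_inverse mult.commute)
  \<comment> \<open>After dividing by \<open>\<tau>\<close>, \<open>r\<close> is lowered to its
    strict bound. In the result \<open>d\<close>, \<open>k\<close> and \<open>e\<close> are
    independent: varying one with the others zero yields in turn the subgradient of
    \<open>g\<close>, that of \<open>h\<close>, and the norm bound.\<close>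
  have key: "0 \<le> a' \<bullet> (A *v d - k) + b' \<bullet> (d - e) + (p - G0 + (h (z + k) - h z) + M * norm e)"
    if "g (x + d) \<le> ereal p" for d k e p
  proof (rule field_le_epsilon)
    fix \<epsilon> :: real assume "\<epsilon> > 0"
    let ?r = "p - G0 + (h (z + k) - h z) + M * norm e + \<epsilon>"
    have "0 \<le> a \<bullet> (A *v d - k) + b \<bullet> (d - e) + \<tau> * ?r"
      using \<open>\<epsilon> > 0\<close> by (intro sep[OF that]) simp
    then have "0 \<le> (a \<bullet> (A *v d - k) + b \<bullet> (d - e) + \<tau> * ?r) / \<tau>"
      using \<tau> by simp
    also have "\<dots> = a' \<bullet> (A *v d - k) + b' \<bullet> (d - e) + ?r"
      using \<tau> by (simp only: a'_inner b'_inner add_divide_distrib) simp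
    finally show "0 \<le> a' \<bullet> (A *v d - k) + b' \<bullet> (d - e)
        + (p - G0 + (h (z + k) - h z) + M * norm e) + \<epsilon>" by simp
  qed
  \<comment> \<open>This is the slope in \<open>d\<close> with its sign reversed, so
    \<open>v + transpose A *v a'\<close> collapses to \<open>- b'\<close>.\<close>
  define v where "v = - (transpose A *v a' + b')"
  have "v \<in> convex_subdifferential g x"
    unfolding convex_subdifferential_def
  proof (safe)
    fix y
    show "g x + ereal (v \<bullet> (y - x)) \<le> g y"
    proof (cases "g y")
      case (real p)
      have "0 \<le> a' \<bullet> (A *v (y - x)) + b' \<bullet> (y - x) + (p - G0)"
        using key[of "y - x" p 0 0] real by simp
      then have "G0 + v \<bullet> (y - x) \<le> p"
        by (simp add: v_def inner_add_left inner_diff_left dot_lmul_matrix)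
      then show ?thesis using real G0 by simp
    next
      case MInf
      \<comment> \<open>At the value -\<infinity> every \<open>p\<close> is admissible in
        \<open>key\<close>; the one chosen here turns it into \<open>0 \<le> - 1\<close>.\<close>
      let ?X = "a' \<bullet> (A *v (y - x)) + b' \<bullet> (y - x)"
      have "0 \<le> ?X + (G0 - ?X - 1 - G0)"
        using key[of "y - x" "G0 - ?X - 1" 0 0] MInf by simp
      then show ?thesis by simp
    qed simp
  qed (use G0 in auto)
  moreover have "a' \<in> convex_subdifferential (\<lambda>z. ereal (h z)) z"
  proof -
    have "h z + a' \<bullet> (y - z) \<le> h y" for y
      using key[of 0 G0 "y - z" 0] G0 by (simp add: inner_diff_right)
    then show ?thesis by (simp add: convex_subdifferential_def)
  qed
  moreover have "norm (v + transpose A *v a') \<le> M"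
  proof -
    have "b' \<bullet> b' \<le> M * norm b'"
      using key[of 0 G0 0 b'] G0 by simp
    then have "norm b' * norm b' \<le> M * norm b'"
      by (simp add: norm_eq_sqrt_inner)
    then have "norm b' \<le> M"
      using \<open>M \<ge> 0\<close> by (cases "b' = 0") auto
    then show ?thesis by (simp add: v_def)
  qed
  ultimately show ?thesis by blast
qed

section \<open>Near-stationary points close to the prox point\<close>

theorem theorem5p3:
  fixes g :: "real^'n \<Rightarrow> ereal"
    and h :: "real^'m \<Rightarrow> real"
    and c :: "real^'n \<Rightarrow> real^'m"
    and L \<beta> t :: real
    and x :: "real^'n"
  assumes "proper_closed_convex g"
    and "convex_on UNIV h"
    and "L-lipschitz_on UNIV h"
    and "\<forall>z. c differentiable (at z)"
    and "continuous_on UNIV (\<lambda>z. jacobian c (at z))"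
    and "\<forall>y z. onorm ((*v) (jacobian c (at y) - jacobian c (at z))) \<le> \<beta> * norm (y - z)"
    and "t > 0"
  shows "\<exists>xhat :: real^'n.
    norm (prox_point g h c t x - xhat) \<le> norm (prox_point g h c t x - x) \<and>
    composite g h c xhat - composite g h c (prox_point g h c t x)
      \<le> ereal (t / 2 * (L * \<beta> * t + 1) * (norm (prox_gradient g h c t x))\<^sup>2) \<and>
    dist_origin (composite_subdifferential g h c xhat)
      \<le> ereal ((3 * L * \<beta> * t + 2) * norm (prox_gradient g h c t x))"
proof -
  define p where "p = prox_point g h c t x"
  define J where "J z = jacobian c (at z)" for z
  define \<delta> where "\<delta> = norm (p - x)"
  \<comment> \<open>\<open>\<kappa> / 2\<close> adds the model error coefficient
    \<open>L * \<beta> / 2\<close> to the proximal one \<open>1 / (2 * t)\<close>. With slope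
    \<open>\<rho>\<close> the penalty at distance \<delta> equals the error
    \<open>L * \<beta> * \<delta>\<^sup>2\<close>.\<close>
  define \<kappa> where "\<kappa> = L * \<beta> + 1 / t"
  define \<rho> where "\<rho> = L * \<beta> * \<delta>"
  have ninf: "g y \<noteq> -\<infinity>" for y
    using assms(1) by (auto simp: proper_closed_convex_def)
  have cl: "closed (ereal_epigraph g)" and cv: "convex (ereal_epigraph g)"
    using assms(1) by (auto simp: proper_closed_convex_def)
  have L: "0 \<le> L" using assms(3) lipschitz_on_nonneg by blast
  have \<beta>: "0 \<le> \<beta>"
  proof -
    obtain u :: "real^'n" where "norm u = 1" using vector_choose_size[of 1] by auto
    then show ?thesis
      using assms(6)[rule_format, of u 0]
        onorm_pos_le[of "(*v) (jacobian c (at u) - jacobian c (at 0))"] by simp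
  qed
  have L\<beta>: "0 \<le> L * \<beta>" using L \<beta> by simp
  have \<kappa>: "0 \<le> \<kappa>" and \<delta>: "0 \<le> \<delta>" and \<rho>: "0 \<le> \<rho>"
    using L\<beta> assms(7) by (simp_all add: \<kappa>_def \<delta>_def \<rho>_def)
  have model: "\<bar>h (c y) - h (c u + J u *v (y - u))\<bar> \<le> L * \<beta> / 2 * (norm (y - u))\<^sup>2" for y u
  proof -
    have "\<bar>h (c y) - h (c u + J u *v (y - u))\<bar> \<le> L * norm (c y - (c u + J u *v (y - u)))"
      using assms(3) by (auto simp: lipschitz_on_def dist_real_def dist_norm)
    also have "\<dots> \<le> L * (\<beta> / 2 * (norm (y - u))\<^sup>2)"
      unfolding J_def by (intro mult_left_mono linearization_error assms L)
    finally show ?thesis by simp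
  qed
  have prox: "g p + ereal (h (c x + J x *v (p - x)) + 1 / (2 * t) * (norm (p - x))\<^sup>2)
      \<le> g y + ereal (h (c x + J x *v (y - x)) + 1 / (2 * t) * (norm (y - x))\<^sup>2)" for y
    using prox_point_minimizes[OF assms(1,3,7), of c x y]
    by (simp add: prox_linear_model_reg_def prox_linear_model_def J_def add.assoc
        norm_minus_commute flip: p_def)
  obtain x0 where "g x0 \<noteq> \<infinity>"
    using assms(1) by (auto simp: proper_closed_convex_def)
  then obtain Gp where Gp: "g p = ereal Gp"
    using prox[of x0] ninf[of p] by (cases "g p"; cases "g x0") auto

  define q where "q y = h (c y) + \<kappa> / 2 * (norm (y - x))\<^sup>2 + \<rho> * norm (y - p)" for y
  \<comment> \<open>\<open>E p\<close> is paid twice, once inside \<open>q p\<close> and once in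
    passing from \<open>h (c p)\<close> to the model; the penalty at \<open>y\<close> covers both.
    The model error at \<open>y\<close> is absorbed by the term \<open>E y\<close> of
    \<open>q y\<close>.\<close>
  have near_min: "g p + ereal (q p) \<le> g y + ereal (q y)" if "\<delta> \<le> norm (y - p)" for y
  proof (cases "g y")
    case (real r)
    define E T where "E u = L * \<beta> / 2 * (norm (u - x))\<^sup>2" and "T u = 1 / (2 * t) * (norm (u - x))\<^sup>2"
      for u
    have q_eq: "q u = h (c u) + E u + T u + \<rho> * norm (u - p)" for u
      by (simp add: q_def \<kappa>_def E_def T_def field_simps)
    have "2 * E p \<le> \<rho> * norm (y - p)"
      using that \<rho> mult_left_mono[of \<delta> "norm (y - p)" \<rho>]
      by (simp add: \<rho>_def \<delta>_def E_def power2_eq_square)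
    moreover have "Gp + (h (c x + J x *v (p - x)) + T p) \<le> r + (h (c x + J x *v (y - x)) + T y)"
      using prox[of y] real Gp by (simp add: T_def)
    moreover have "h (c p) \<le> h (c x + J x *v (p - x)) + E p"
      using model[of p x] unfolding E_def by linarith
    moreover have "h (c x + J x *v (y - x)) \<le> h (c y) + E y"
      using model[of y x] unfolding E_def by linarith
    moreover have "q p = h (c p) + E p + T p" using q_eq[of p] by simp
    ultimately have "Gp + q p \<le> r + q y"
      using q_eq[of y] by linarith
    then show ?thesis using real Gp by simp
  qed (use ninf in auto)
  have contq: "continuous_on UNIV q"
  proof -
    have "continuous_on UNIV c"
      using assms(4) by (simp add: continuous_at_imp_continuous_on differentiable_imp_continuous_within)
    then show ?thesis
      unfolding q_def
      by (intro continuous_intros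
          continuous_on_compose2[OF lipschitz_on_continuous_on[OF assms(3)]]) auto
  qed
  have p_ball: "cball p \<delta> \<noteq> {}" using \<delta> by simp
  obtain z where z: "z \<in> cball p \<delta>"
    and zball: "\<And>y. y \<in> cball p \<delta> \<Longrightarrow> g z + ereal (q z) \<le> g y + ereal (q y)"
    using closed_epigraph_attains_min[OF closed_ereal_epigraph_add[OF cl contq] compact_cball] p_ball
    by blast
  have zmin: "g z + ereal (q z) \<le> g y + ereal (q y)" for y
  proof (cases "y \<in> cball p \<delta>")
    case False
    have "g z + ereal (q z) \<le> g p + ereal (q p)" using zball[of p] \<delta> by simp
    also have "\<dots> \<le> g y + ereal (q y)"
      using False by (intro near_min) (simp add: dist_norm norm_minus_commute)
    finally show ?thesis .
  qed (rule zball)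
  obtain Gz where Gz: "g z = ereal Gz"
    using zmin[of p] ninf[of z] Gp by (cases "g z") auto
  have zp: "norm (p - z) \<le> \<delta>" using z by (simp add: dist_norm)
  have zx: "norm (z - x) \<le> 2 * \<delta>"
    using norm_triangle_ineq[of "z - p" "p - x"] zp by (simp add: \<delta>_def norm_minus_commute)
  have Gt: "norm (prox_gradient g h c t x) = \<delta> / t"
    using assms(7) by (simp add: prox_gradient_def \<delta>_def norm_minus_commute flip: p_def)

  have value_gap: "composite g h c z - composite g h c p
      \<le> ereal (t / 2 * (L * \<beta> * t + 1) * (\<delta> / t)\<^sup>2)"
  proof -
    have "Gz + q z \<le> Gp + q p" using zmin[of p] Gz Gp by simp
    moreover have "0 \<le> \<kappa> / 2 * (norm (z - x))\<^sup>2" "0 \<le> \<rho> * norm (z - p)" using \<kappa> \<rho> by simp_all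
    ultimately have "(Gz + h (c z)) - (Gp + h (c p)) \<le> \<kappa> / 2 * \<delta>\<^sup>2"
      by (simp add: q_def \<delta>_def)
    also have "\<dots> = t / 2 * (L * \<beta> * t + 1) * (\<delta> / t)\<^sup>2"
      using assms(7) by (simp add: \<kappa>_def field_simps power2_eq_square)
    finally show ?thesis by (simp add: composite_def Gz Gp)
  qed

  \<comment> \<open>The first summand is the gradient norm at \<open>z\<close> of the quadratic term
    of \<open>q\<close>, the second the Lipschitz constant of the penalty.\<close>
  define M where "M = \<kappa> * norm (z - x) + \<rho>"
  have M: "0 \<le> M" using \<kappa> \<rho> by (simp add: M_def)
  have stationary: "g z + ereal (h (c z)) \<le> g (z + d) + ereal (h (c z + J z *v d) + M * norm d)" for d
  proof (cases "g (z + d)")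
    case (real r)
    \<comment> \<open>\<open>z\<close> is compared with \<open>z + s *\<^sub>R d\<close>.
      \<open>E\<close> gathers the terms of first order in \<open>s\<close>; \<open>K\<close>
      gathers those of second order, from the linearization error at \<open>z\<close> and from the
      quadratic term. Dividing by \<open>s\<close> and letting it tend to 0 leaves
      \<open>0 \<le> E\<close>.\<close>
    define E where "E = r - Gz + h (c z + J z *v d) - h (c z) + M * norm d"
    define K where "K = (L * \<beta> + \<kappa>) / 2 * (norm d)\<^sup>2"
    have slope: "0 \<le> E + s * K" if s: "0 < s" "s < 1" for s
    proof -
      have "z + s *\<^sub>R d = (1 - s) *\<^sub>R z + s *\<^sub>R (z + d)" by (simp add: algebra_simps)
      then have "g (z + s *\<^sub>R d) \<le> ereal ((1 - s) * Gz + s * r)"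
        using convex_epigraphD[OF cv, of z Gz "z + d" r "1 - s" s] s real Gz by simp
      then have "g z + ereal (q z) \<le> ereal ((1 - s) * Gz + s * r) + ereal (q (z + s *\<^sub>R d))"
        using zmin[of "z + s *\<^sub>R d"] by (meson add_right_mono order_trans)
      then have 1: "Gz + q z \<le> (1 - s) * Gz + s * r + q (z + s *\<^sub>R d)" using Gz by simp
      \<comment> \<open>The model is now centered at \<open>z\<close> instead of \<open>x\<close>,
        and convexity of \<open>h\<close> bounds it by interpolation between \<open>s = 0\<close>
        and \<open>s = 1\<close>.\<close>
      have "c z + J z *v (s *\<^sub>R d) = (1 - s) *\<^sub>R c z + s *\<^sub>R (c z + J z *v d)"
        by (simp add: matrix_vector_mult_scaleR algebra_simps)
      then have "h (c z + J z *v (s *\<^sub>R d)) \<le> (1 - s) * h (c z) + s * h (c z + J z *v d)"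
        using assms(2) s by (simp add: convex_on_def)
      moreover have "h (c (z + s *\<^sub>R d)) \<le> h (c z + J z *v (s *\<^sub>R d)) + L * \<beta> / 2 * (s\<^sup>2 * (norm d)\<^sup>2)"
        using abs_le_D1[OF model[of "z + s *\<^sub>R d" z]]
        by (simp only: add_diff_cancel_left' norm_scaleR power_mult_distrib power2_abs)
      moreover have "\<kappa> / 2 * (norm (z + s *\<^sub>R d - x))\<^sup>2
          \<le> \<kappa> / 2 * ((norm (z - x))\<^sup>2 + 2 * s * norm (z - x) * norm d + s\<^sup>2 * (norm d)\<^sup>2)"
      proof (intro mult_left_mono)
        have "norm (z + s *\<^sub>R d - x) \<le> norm (z - x) + s * norm d"
          using norm_triangle_ineq[of "z - x" "s *\<^sub>R d"] s by (simp add: algebra_simps)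
        then have "(norm (z + s *\<^sub>R d - x))\<^sup>2 \<le> (norm (z - x) + s * norm d)\<^sup>2"
          by (intro power_mono) auto
        then show "(norm (z + s *\<^sub>R d - x))\<^sup>2
            \<le> (norm (z - x))\<^sup>2 + 2 * s * norm (z - x) * norm d + s\<^sup>2 * (norm d)\<^sup>2"
          by (simp add: power2_sum power_mult_distrib algebra_simps)
      qed (use \<kappa> in simp)
      moreover have "\<rho> * norm (z + s *\<^sub>R d - p) \<le> \<rho> * (norm (z - p) + s * norm d)"
        using norm_triangle_ineq[of "z - p" "s *\<^sub>R d"] s \<rho>
        by (intro mult_left_mono) (simp_all add: algebra_simps)
      moreover have "s * (E + s * K) = s * r - s * Gz + s * h (c z + J z *v d) - s * h (c z)
          + (\<kappa> / 2 * (2 * s * norm (z - x) * norm d) + \<rho> * (s * norm d))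
          + (L * \<beta> / 2 * (s\<^sup>2 * (norm d)\<^sup>2) + \<kappa> / 2 * (s\<^sup>2 * (norm d)\<^sup>2))"
        unfolding E_def K_def M_def
        by (simp add: algebra_simps power2_eq_square add_divide_distrib)
      ultimately have "0 \<le> s * (E + s * K)"
        using 1 unfolding q_def distrib_left left_diff_distrib by simp
      then show ?thesis using s by (simp add: zero_le_mult_iff)
    qed
    have "0 \<le> E"
    proof (rule tendsto_lowerbound)
      show "((\<lambda>s. E + s * K) \<longlongrightarrow> E) (at_right 0)"
        by (auto intro!: tendsto_eq_intros)
      show "\<forall>\<^sub>F s in at_right 0. 0 \<le> E + s * K"
        using slope by (auto simp: eventually_at_right[of 0 1] intro!: exI[of _ 1])
    qed simp
    then show ?thesis using real Gz by (simp add: E_def)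
  qed (use ninf in auto)
  obtain v w where vw: "v \<in> convex_subdifferential g z"
    "w \<in> convex_subdifferential (\<lambda>z. ereal (h z)) (c z)" "norm (v + transpose (J z) *v w) \<le> M"
    using approximate_subdifferential_chain_rule[OF cv assms(2) M Gz stationary] by blast
  \<comment> \<open>Two of the three multiples of \<open>L * \<beta>\<close> come from
    \<open>norm (z - x) \<le> 2 * \<delta>\<close>, the third from the penalty slope
    \<open>\<rho>\<close>.\<close>
  have "M \<le> \<kappa> * (2 * \<delta>) + \<rho>"
    unfolding M_def using zx \<kappa> by (intro add_right_mono mult_left_mono)
  also have "\<dots> = (3 * L * \<beta> * t + 2) * (\<delta> / t)"
    using assms(7) by (simp add: \<kappa>_def \<rho>_def field_simps)
  finally have "dist_origin (composite_subdifferential g h c z)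
      \<le> ereal ((3 * L * \<beta> * t + 2) * (\<delta> / t))"
    unfolding dist_origin_def composite_subdifferential_def
    using vw by (intro INF_lower2[of "v + transpose (J z) *v w"]) (auto simp: J_def)
  then show ?thesis
    using zp value_gap unfolding Gt p_def[symmetric] \<delta>_def by blast
qed

end
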